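(* Let $T,n_x,n_u$ be positive integers, $\ell=T(n_x+n_u)$, and let $C\in\mathbb{R}^{Tn_x\times\ell}$ be the matrix of MPC equality constraints $$C=\begin{bmatrix}\mathcal{B}_0&-I&0&&\ldots&&0\\0&\mathcal{A}_1&\mathcal{B}_1&-I&0&\ldots&0\\\vdots&&&\vdots&&&\vdots\\0&\ldots&&0&\mathcal{A}_{T-1}&\mathcal{B}_{T-1}&-I\end{bmatrix},$$ with $\mathcal{A}_k\in\mathbb{R}^{n_x\times n_x}$ and $\mathcal{B}_k\in\mathbb{R}^{n_x\times n_u}$. The algorithm QR-MPC (defined in the context) computes the QR decomposition $[Q_1\ \ Q_2]\begin{bmatrix}R_1\\0\end{bmatrix}=C'$, where $[Q_1\ \ Q_2]\in\mathbb{R}^{\ell\times\ell}$ is orthogonal, $Q_1\in\mathbb{R}^{\ell\times Tn_x}$, $Q_2\in\mathbb{R}^{\ell\times Tn_u}$, and $R_1\in\mathbb{R}^{Tn_x\times Tn_x}$ is upper triangular, and enjoys the following properties: (i) The serial complexity $\chi_{\mathrm{QR}}$ of QR-MPC, namely the total number of flops required for termination without any parallel computation, is $$\chi_{\mathrm{QR}}=T^3(n_x^2n_u+n_xn_u^2)+3T^2n_un_x(2n_x+n_u+1)+\mathcal{O}(T).$$ (ii) QR-MPC saves a total of $$\chi_{\mathrm{QRS}}-\chi_{\mathrm{QR}}=T^3(5n_x^3+11n_x^2n_u+5n_xn_u^2)-\mathcal{O}(T^2)$$ flops, where $\chi_{\mathrm{QRS}}$ is the complexity of a standard non-economy QR decomposition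 algorithm relying on Givens rotations for column annihilation, applied to $C'$.
   Context: The prime denotes transpose. The columns of $C$ correspond to the optimization vector $z=[u_0'\ x_1'\ \ldots\ u_{T-1}'\ x_T']'$ with $u_k\in\mathbb{R}^{n_u}$, $x_k\in\mathbb{R}^{n_x}$, and the rows encode the dynamics $x_{k+1}=\mathcal{A}_kx_k+\mathcal{B}_ku_k$, $k=0,\dots,T-1$, over a prediction horizon of $T$ steps. It is assumed that $\mathrm{rank}(C)=Tn_x$. $Y_{i:j,h:k}$ denotes the submatrix of $Y$ with row indices from $i$ to $j$ and column indices from $h$ to $k$. QR-MPC algorithm. Input: $C$, $n_u$, $n_x$, $T$, a zero-detection tolerance $\epsilon_0$. 1. $Q\leftarrow I_\ell$. 2. $R\leftarrow C'$. 3. For $j=1,\dots,Tn_x$: - $k\leftarrow\lfloor\frac{j-1}{n_x}\rfloor$; $r_1\leftarrow j+n_u(k+1)$; $r_2\leftarrow n_x\min(k+2,T)$; - for $i=r_1,r_1-1,\dots,j+1$ (descending): - $q_1\leftarrow 1+(n_x+n_u)\lfloor\frac{i-j-1}{n_u}\rfloor$; - if $|R_{i,j}|>\epsilon_0$: set $c\leftarrow R_{i-1,j}/\sqrt{R_{i-1,j}^2+R_{i,j}^2}$, $s\leftarrow -R_{i,j}/\sqrt{R_{i-1,j}^2+R_{i,j}^2}$, then (R-step) $R_{i-1:i,\,j:r_2}\leftarrow\begin{bmatrix}c&s\\-s&c\end{bmatrix}'R_{i-1:i,\,j:r_2}$, (Q-step) $Q_{q_1:r_1,\,i-1:i}\leftarrow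 Q_{q_1:r_1,\,i-1:i}\begin{bmatrix}c&s\\-s&c\end{bmatrix}$. 4. End. Output: orthogonal $Q=[Q_1\ \ Q_2]\in\mathbb{R}^{\ell\times\ell}$ and upper triangular $R=\begin{bmatrix}R_1\\0\end{bmatrix}\in\mathbb{R}^{\ell\times Tn_x}$ with $QR=C'$. Flop-counting conventions. Arithmetic is exact; for the decomposition to be exact the tolerance is read as $\epsilon_0=0$. The product of an $m\times n$ matrix by an $n\times p$ matrix costs $mp(2n-1)$ flops. The complexity of QR-MPC is $\chi_{\mathrm{QR}}=\chi(R)+\chi(Q)$, where $\chi(R)$ is the total cost of all executions of the R-step (each costing $6(r_2-j+1)$ flops) and $\chi(Q)$ is the total cost of all executions of the Q-step (each costing $6(r_1-q_1+1)$ flops), all rotations of the loops being counted (none skipped by the zero test). The standard non-economy Givens QR algorithm, applied to an $m\times n$ matrix of full rank ($m\ge n$) treated as dense with the orthogonal factor formed explicitly, annihilates for $j=1,\dots,n$ all entries in rows $i=m,\dots,j+1$ of column $j$, each rotation being applied to $n-j+1$ columns of $R$ and to $m$ rows of $Q$, so its complexity is $\sum_{j=1}^n\sum_{i=j+1}^m6(m+n-j+1)$; $\chi_{\mathrm{QRS}}$ is this quantity with $m=T(n_x+n_u)$ and $n=Tn_x$. The symbols $\mathcal{O}(T)$ and $\mathcal{O}(T^2)$ refer to growth in $T$ with $n_x$ and $n_u$ fixed. *)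

theory Defs
  imports
    "Jordan_Normal_Form.DL_Rank"
    "Jordan_Normal_Form.DL_Submatrix"
    "HOL-Library.Landau_Symbols"
begin

section \<open>The matrix of equality constraints\<close>

text \<open>Block row \<open>k\<close> (for \<open>k < T\<close>) has \<open>nx\<close> rows; block column \<open>h\<close> (for \<open>h < T\<close>) has \<open>nu + nx\<close>
  columns, belonging to the pair \<open>(u\<^sub>h, x\<^sub>h\<^sub>+\<^sub>1)\<close>. The initial state is not an optimization
  variable, so \<open>A 0\<close> does not occur.\<close>

definition mpc_mat :: "nat \<Rightarrow> nat \<Rightarrow> nat \<Rightarrow> (nat \<Rightarrow> real mat) \<Rightarrow> (nat \<Rightarrow> real mat) \<Rightarrow> real mat" where
  "mpc_mat nx nu T A B = mat (T * nx) (T * (nx + nu)) (\<lambda>(r, c).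
     let k = r div nx; a = r mod nx; h = c div (nu + nx); b = c mod (nu + nx) in
     if b < nu then (if h = k then B k $$ (a, b) else 0)
     else if h = k then (- 1\<^sub>m nx) $$ (a, b - nu)
     else if Suc h = k then A k $$ (a, b - nu)
     else 0)"


section \<open>Submatrices with 1-based, inclusive index ranges\<close>

text \<open>The algorithm is stated with indices starting at 1, whereas \<open>$$\<close> and \<open>submatrix\<close>
  index from 0.\<close>

definition entry :: "'a mat \<Rightarrow> nat \<Rightarrow> nat \<Rightarrow> 'a" where
  "entry M i j = M $$ (i - 1, j - 1)"

definition block :: "'a mat \<Rightarrow> nat \<Rightarrow> nat \<Rightarrow> nat \<Rightarrow> nat \<Rightarrow> 'a mat" where
  "block M i j h k = submatrix M {i - 1..<j} {h - 1..<k}"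

text \<open>The matrix \<open>M\<close> after the assignment of \<open>N\<close> to the block whose top left corner is the
  entry in row \<open>i\<close> and column \<open>h\<close> (1-based).\<close>

definition put_block :: "'a mat \<Rightarrow> nat \<Rightarrow> nat \<Rightarrow> 'a mat \<Rightarrow> 'a mat" where
  "put_block M i h N = mat (dim_row M) (dim_col M) (\<lambda>(a, b).
     if a \<in> {i - 1..<i - 1 + dim_row N} \<and> b \<in> {h - 1..<h - 1 + dim_col N}
     then N $$ (a - (i - 1), b - (h - 1)) else M $$ (a, b))"

definition append_cols :: "'a::zero mat \<Rightarrow> 'a mat \<Rightarrow> 'a mat" (infixr \<open>@\<^sub>c\<close> 65) where
  "M @\<^sub>c N = four_block_mat M N (0\<^sub>m 0 (dim_col M)) (0\<^sub>m 0 (dim_col N))"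


section \<open>QR-MPC\<close>

definition qr_mpc_r1 :: "nat \<Rightarrow> nat \<Rightarrow> nat \<Rightarrow> nat" where
  "qr_mpc_r1 nx nu j = (let k = (j - 1) div nx in j + nu * (k + 1))"

definition qr_mpc_r2 :: "nat \<Rightarrow> nat \<Rightarrow> nat \<Rightarrow> nat" where
  "qr_mpc_r2 nx T j = (let k = (j - 1) div nx in nx * min (k + 2) T)"

definition qr_mpc_q1 :: "nat \<Rightarrow> nat \<Rightarrow> nat \<Rightarrow> nat \<Rightarrow> nat" where
  "qr_mpc_q1 nx nu j i = 1 + (nx + nu) * ((i - j - 1) div nu)"

text \<open>The pairs \<open>(j, i)\<close> visited by the two nested loops, in order of execution:
  \<open>j\<close> ascends from 1 to \<open>T * nx\<close> and \<open>i\<close> descends from \<open>r1\<close> to \<open>j + 1\<close>.\<close>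

definition qr_mpc_loop :: "nat \<Rightarrow> nat \<Rightarrow> nat \<Rightarrow> (nat \<times> nat) list" where
  "qr_mpc_loop nx nu T =
     concat (map (\<lambda>j. map (Pair j) (rev [j + 1..<qr_mpc_r1 nx nu j + 1])) [1..<T * nx + 1])"

definition givens_mat :: "real \<Rightarrow> real \<Rightarrow> real mat" where
  "givens_mat c s = mat_of_rows_list 2 [[c, s], [- s, c]]"

fun qr_mpc_step ::
  "nat \<Rightarrow> nat \<Rightarrow> nat \<Rightarrow> real \<Rightarrow> nat \<times> nat \<Rightarrow> real mat \<times> real mat \<Rightarrow> real mat \<times> real mat" where
  "qr_mpc_step nx nu T \<epsilon>\<^sub>0 (j, i) (Q, R) =
     (let r1 = qr_mpc_r1 nx nu j; r2 = qr_mpc_r2 nx T j; q1 = qr_mpc_q1 nx nu j i in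
      if \<bar>entry R i j\<bar> > \<epsilon>\<^sub>0
      then
        let d = sqrt ((entry R (i - 1) j)\<^sup>2 + (entry R i j)\<^sup>2);
            c = entry R (i - 1) j / d;
            s = - entry R i j / d;
            G = givens_mat c s
        in (put_block Q q1 (i - 1) (block Q q1 r1 (i - 1) i * G),
            put_block R (i - 1) j (transpose_mat G * block R (i - 1) i j r2))
      else (Q, R))"

definition qr_mpc :: "real mat \<Rightarrow> nat \<Rightarrow> nat \<Rightarrow> nat \<Rightarrow> real \<Rightarrow> real mat \<times> real mat" where
  "qr_mpc C nu nx T \<epsilon>\<^sub>0 =
     fold (qr_mpc_step nx nu T \<epsilon>\<^sub>0) (qr_mpc_loop nx nu T)
       (1\<^sub>m (T * (nx + nu)), transpose_mat C)"


section \<open>Flop counts\<close>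

text \<open>Cost of multiplying an \<open>m \<times> n\<close> matrix by an \<open>n \<times> p\<close> matrix.\<close>

definition mult_flops :: "nat \<Rightarrow> nat \<Rightarrow> nat \<Rightarrow> nat" where
  "mult_flops m n p = m * p * (2 * n - 1)"

text \<open>All rotations of the loops are counted, also those which the zero test would skip; hence
  the counts depend on the dimensions only.\<close>

definition chi_R :: "nat \<Rightarrow> nat \<Rightarrow> nat \<Rightarrow> nat" where
  "chi_R nx nu T = (\<Sum>(j, i)\<leftarrow>qr_mpc_loop nx nu T. mult_flops 2 2 (qr_mpc_r2 nx T j - j + 1))"

definition chi_Q :: "nat \<Rightarrow> nat \<Rightarrow> nat \<Rightarrow> nat" where
  "chi_Q nx nu T = (\<Sum>(j, i)\<leftarrow>qr_mpc_loop nx nu T.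
     mult_flops (qr_mpc_r1 nx nu j - qr_mpc_q1 nx nu j i + 1) 2 2)"

definition chi_QR :: "nat \<Rightarrow> nat \<Rightarrow> nat \<Rightarrow> nat" where
  "chi_QR nx nu T = chi_R nx nu T + chi_Q nx nu T"

text \<open>Dense non-economy Givens QR of an \<open>m \<times> n\<close> matrix, \<open>m \<ge> n\<close>: the entry in row \<open>i\<close> and column
  \<open>j\<close> is annihilated by a rotation of \<open>n - j + 1\<close> columns of \<open>R\<close> and of \<open>m\<close> rows of \<open>Q\<close>.\<close>

definition givens_qr_flops :: "nat \<Rightarrow> nat \<Rightarrow> nat" where
  "givens_qr_flops m n =
     (\<Sum>j = 1..n. \<Sum>i = j + 1..m. mult_flops 2 2 (n - j + 1) + mult_flops m 2 2)"

definition chi_QRS :: "nat \<Rightarrow> nat \<Rightarrow> nat \<Rightarrow> nat" where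
  "chi_QRS nx nu T = givens_qr_flops (T * (nx + nu)) (T * nx)"

lemma mult_flops_rotation: "mult_flops 2 2 w = 6 * w" "mult_flops w 2 2 = 6 * w"
  by (simp_all add: mult_flops_def)

lemma givens_qr_flops_eq:
  "givens_qr_flops m n = (\<Sum>j = 1..n. \<Sum>i = j + 1..m. 6 * (m + n - j + 1))"
  unfolding givens_qr_flops_def mult_flops_rotation by (intro sum.cong) auto

end

(*
  The rotations for column j act on adjacent rows between j and the last nonzero row r1 of that
  column, and r1 grows with j, so the band structure of C' is never destroyed.  Hence every entry
  which the truncated R-step leaves alone is zero in both rotated rows.  Likewise the columns of
  the identity that have not been rotated are unit vectors, and during one sweep the nonzero
  rows of a column of Q at worst extend up to those of its left neighbour, so the truncated Q-step
  omits only zeros.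
  Each step is therefore a full rotation, which preserves QQ' = I and QR = C'.  The flop counts are
  polynomials in T with explicitly computable coefficients.
*)
theory Submission
  imports Defs
begin

section \<open>Plane rotations\<close>

text \<open>The row vector \<open>(f p, f q)\<close> times \<open>givens_mat c s\<close>. Vectors
  are functions, so that one notion serves the rows of \<open>Q\<close> and the columns of
  \<open>R\<close>.\<close>

definition plane_rot :: "nat \<Rightarrow> nat \<Rightarrow> real \<Rightarrow> real \<Rightarrow> (nat \<Rightarrow> real) \<Rightarrow> nat \<Rightarrow> real" where
  "plane_rot p q c s f = f(p := c * f p - s * f q, q := s * f p + c * f q)"

lemma plane_rot_other: "x \<noteq> p \<Longrightarrow> x \<noteq> q \<Longrightarrow> plane_rot p q c s f x = f x"
  by (simp add: plane_rot_def)

lemma plane_rot_trivial: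
  assumes "f p = 0" "f q = 0"
  shows "plane_rot p q c s f x = f x"
  using assms by (simp add: plane_rot_def)

text \<open>The mixed products cancel and \<open>c\<^sup>2 + s\<^sup>2\<close> factors out of the
  two rotated terms.\<close>

lemma sum_plane_rot:
  assumes "finite S" "p \<in> S" "q \<in> S" "p \<noteq> q" "c\<^sup>2 + s\<^sup>2 = 1"
  shows "(\<Sum>x\<in>S. plane_rot p q c s f x * plane_rot p q c s g x) = (\<Sum>x\<in>S. f x * g x)"
proof -
  have split: "sum h S = h p + h q + sum h (S - {p} - {q})" for h :: "nat \<Rightarrow> real"
    using assms by (simp add: sum.remove[of S p] sum.remove[of "S - {p}" q])
  have "(c * f p - s * f q) * (c * g p - s * g q) + (s * f p + c * f q) * (s * g p + c * g q)
      = (c\<^sup>2 + s\<^sup>2) * (f p * g p + f q * g q)"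
    by (simp add: algebra_simps power2_eq_square)
  then have "(c * f p - s * f q) * (c * g p - s * g q) + (s * f p + c * f q) * (s * g p + c * g q)
      = f p * g p + f q * g q"
    using assms by simp
  moreover have "(\<Sum>x\<in>S - {p} - {q}. plane_rot p q c s f x * plane_rot p q c s g x)
      = (\<Sum>x\<in>S - {p} - {q}. f x * g x)"
    by (intro sum.cong) (auto simp: plane_rot_def)
  ultimately show ?thesis
    using assms by (simp add: split plane_rot_def)
qed

definition rot_cols :: "nat \<Rightarrow> nat \<Rightarrow> real \<Rightarrow> real \<Rightarrow> real mat \<Rightarrow> real mat" where
  "rot_cols p q c s M =
     mat (dim_row M) (dim_col M) (\<lambda>(i, j). plane_rot p q c s (\<lambda>k. M $$ (i, k)) j)"

definition rot_rows :: "nat \<Rightarrow> nat \<Rightarrow> real \<Rightarrow> real \<Rightarrow> real mat \<Rightarrow> real mat" where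
  "rot_rows p q c s M =
     mat (dim_row M) (dim_col M) (\<lambda>(i, j). plane_rot p q c s (\<lambda>k. M $$ (k, j)) i)"

lemma rot_cols_carrier [simp, intro]: "M \<in> carrier_mat m n \<Longrightarrow> rot_cols p q c s M \<in> carrier_mat m n"
  by (auto simp: rot_cols_def)

lemma rot_rows_carrier [simp, intro]: "M \<in> carrier_mat m n \<Longrightarrow> rot_rows p q c s M \<in> carrier_mat m n"
  by (auto simp: rot_rows_def)

lemma transpose_rot_cols:
  assumes "p < dim_col M" "q < dim_col M"
  shows "transpose_mat (rot_cols p q c s M) = rot_rows p q c s (transpose_mat M)"
  using assms by (intro eq_matI) (auto simp: rot_cols_def rot_rows_def plane_rot_def)

text \<open>This is M G G' N = M N for the rotation G embedded in an identity matrix. Taking N to be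
  \<open>R\<close> preserves the product of the factors; taking N to be the transpose of
  \<open>Q\<close> preserves orthogonality.\<close>

lemma rot_cols_mult_rot_rows:
  assumes "M \<in> carrier_mat m n" "N \<in> carrier_mat n k"
    and "p < n" "q < n" "p \<noteq> q" "c\<^sup>2 + s\<^sup>2 = 1"
  shows "rot_cols p q c s M * rot_rows p q c s N = M * N"
proof (rule eq_matI)
  fix i j assume "i < dim_row (M * N)" "j < dim_col (M * N)"
  then show "(rot_cols p q c s M * rot_rows p q c s N) $$ (i, j) = (M * N) $$ (i, j)"
    using assms sum_plane_rot[of "{0..<n}" p q c s "\<lambda>x. M $$ (i, x)" "\<lambda>x. N $$ (x, j)"]
    by (auto simp: rot_cols_def rot_rows_def scalar_prod_def)
qed (use assms in \<open>auto simp: rot_cols_def rot_rows_def\<close>)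

section \<open>Block updates\<close>

lemma pick_atLeastLessThan: "i < b - a \<Longrightarrow> pick {a..<b} i = a + i"
proof (induction i)
  case 0
  then show ?case by (auto intro!: Least_equality)
next
  case (Suc i)
  then show ?case by (auto intro!: Least_equality)
qed

text \<open>\<open>submatrix\<close> counts only indices inside the matrix; the two bounds make its
  cardinalities full lengths. \<open>Suc\<close> absorbs the 1-based start indices.\<close>

lemma block_eq:
  assumes "j \<le> dim_row M" "k \<le> dim_col M"
  shows "block M (Suc i) j (Suc h) k = mat (j - i) (k - h) (\<lambda>(a, b). M $$ (i + a, h + b))"
proof -
  have "{x. x < dim_row M \<and> i \<le> x \<and> x < j} = {i..<j}" "{x. x < dim_col M \<and> h \<le> x \<and> x < k} = {h..<k}"
    using assms by auto
  then have "card {x. x < dim_row M \<and> i \<le> x \<and> x < j} = j - i"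
      "card {x. x < dim_col M \<and> h \<le> x \<and> x < k} = k - h"
    by simp_all
  then show ?thesis
    by (auto simp: block_def submatrix_def pick_atLeastLessThan intro!: cong_mat)
qed

lemma givens_mat_index [simp]:
  "givens_mat c s $$ (0, 0) = c" "givens_mat c s $$ (0, Suc 0) = s"
  "givens_mat c s $$ (Suc 0, 0) = - s" "givens_mat c s $$ (Suc 0, Suc 0) = c"
  by (simp_all add: givens_mat_def mat_of_rows_list_def)

lemma givens_mat_carrier [simp]: "givens_mat c s \<in> carrier_mat 2 2"
  by (simp add: givens_mat_def mat_of_rows_list_def numeral_2_eq_2)

lemma givens_mat_dim [simp]: "dim_row (givens_mat c s) = 2" "dim_col (givens_mat c s) = 2"
  using givens_mat_carrier by (blast dest: carrier_matD)+

text \<open>A rotation fixes the zero pair, so rows in which both columns vanish may be left out of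
  the update.\<close>

lemma put_block_rot_cols:
  assumes "Suc p < dim_col M" "j \<le> dim_row M"
    and zero: "\<And>a. a < dim_row M \<Longrightarrow> a < i \<or> j \<le> a \<Longrightarrow> M $$ (a, p) = 0 \<and> M $$ (a, Suc p) = 0"
  shows "put_block M (Suc i) (Suc p) (block M (Suc i) j (Suc p) (Suc (Suc p)) * givens_mat c s)
    = rot_cols p (Suc p) c s M"
proof (rule eq_matI)
  fix a b
  assume ab: "a < dim_row (rot_cols p (Suc p) c s M)" "b < dim_col (rot_cols p (Suc p) c s M)"
  then have less: "a < dim_row M" "b < dim_col M"
    by (auto simp: rot_cols_def)
  have index: "(mat (j - i) 2 (\<lambda>(a, b). M $$ (i + a, p + b)) * givens_mat c s) $$ (a - i, b - p)
      = plane_rot p (Suc p) c s (\<lambda>k. M $$ (a, k)) b"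
    if "i \<le> a" "a < j" "b = p \<or> b = Suc p"
    using that by (auto simp: scalar_prod_def plane_rot_def numeral_2_eq_2 algebra_simps)
  show "put_block M (Suc i) (Suc p) (block M (Suc i) j (Suc p) (Suc (Suc p)) * givens_mat c s) $$ (a, b)
      = rot_cols p (Suc p) c s M $$ (a, b)"
  proof (cases "i \<le> a \<and> a < j \<and> (b = p \<or> b = Suc p)")
    case True
    then have "i \<le> a" "a < j" "b = p \<or> b = Suc p" by auto
    with index[OF this] show ?thesis
      using assms less by (auto simp: block_eq put_block_def rot_cols_def)
  next
    case False
    have "plane_rot p (Suc p) c s (\<lambda>k. M $$ (a, k)) b = M $$ (a, b)"
    proof (cases "i \<le> a \<and> a < j")
      case True
      then show ?thesis using False by (intro plane_rot_other) auto
    next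
      case False
      then show ?thesis using zero[of a] less by (intro plane_rot_trivial) auto
    qed
    then show ?thesis
      using False assms less by (auto simp: block_eq put_block_def rot_cols_def)
  qed
qed (auto simp: put_block_def rot_cols_def)

lemma put_block_rot_rows:
  assumes "Suc p < dim_row M" "k \<le> dim_col M"
    and zero: "\<And>b. b < dim_col M \<Longrightarrow> b < h \<or> k \<le> b \<Longrightarrow> M $$ (p, b) = 0 \<and> M $$ (Suc p, b) = 0"
  shows "put_block M (Suc p) (Suc h)
      (transpose_mat (givens_mat c s) * block M (Suc p) (Suc (Suc p)) (Suc h) k)
    = rot_rows p (Suc p) c s M"
proof (rule eq_matI)
  fix a b
  assume ab: "a < dim_row (rot_rows p (Suc p) c s M)" "b < dim_col (rot_rows p (Suc p) c s M)"
  then have less: "a < dim_row M" "b < dim_col M"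
    by (auto simp: rot_rows_def)
  have index: "(transpose_mat (givens_mat c s) * mat 2 (k - h) (\<lambda>(a, b). M $$ (p + a, h + b))) $$ (a - p, b - h)
      = plane_rot p (Suc p) c s (\<lambda>k. M $$ (k, b)) a"
    if "h \<le> b" "b < k" "a = p \<or> a = Suc p"
    using that by (auto simp: scalar_prod_def plane_rot_def numeral_2_eq_2 algebra_simps)
  show "put_block M (Suc p) (Suc h)
      (transpose_mat (givens_mat c s) * block M (Suc p) (Suc (Suc p)) (Suc h) k) $$ (a, b)
      = rot_rows p (Suc p) c s M $$ (a, b)"
  proof (cases "h \<le> b \<and> b < k \<and> (a = p \<or> a = Suc p)")
    case True
    then have "h \<le> b" "b < k" "a = p \<or> a = Suc p" by auto
    with index[OF this] show ?thesis
      using assms less by (auto simp: block_eq put_block_def rot_rows_def)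
  next
    case False
    have "plane_rot p (Suc p) c s (\<lambda>k. M $$ (k, b)) a = M $$ (a, b)"
    proof (cases "h \<le> b \<and> b < k")
      case True
      then show ?thesis using False by (intro plane_rot_other) auto
    next
      case False
      then show ?thesis using zero[of b] less by (intro plane_rot_trivial) auto
    qed
    then show ?thesis
      using False assms less by (auto simp: block_eq put_block_def rot_rows_def)
  qed
qed (auto simp: put_block_def rot_rows_def)

section \<open>The band structure is invariant\<close>

locale qr_mpc_dims =
  fixes nx nu T :: nat
  assumes nx_pos: "nx > 0" and nu_pos: "nu > 0"
begin

text \<open>The 0-based row of the entry -1 in column \<open>J\<close> of the transposed constraint
  matrix; in the 1-based terms of the algorithm, \<open>r1 - 1\<close>.\<close>

definition last_row :: "nat \<Rightarrow> nat" where
  "last_row J = J + nu * (J div nx + 1)"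

lemma last_row_mono: "J \<le> K \<Longrightarrow> last_row J \<le> last_row K"
  unfolding last_row_def by (intro add_mono mult_le_mono2 div_le_mono) auto

text \<open>The sweep over column \<open>J\<close> therefore stays inside the first
  \<open>J div nx + 1\<close> row blocks, clear of the nonzero rows of columns two blocks further
  right.\<close>

lemma last_row_less: "last_row J < (nx + nu) * (J div nx + 1)"
proof -
  have "J < nx * (J div nx + 1)"
    using dividend_less_times_div[OF nx_pos, of J] by simp
  then show ?thesis
    by (simp add: last_row_def algebra_simps)
qed

lemma div_less_T: "J < T * nx \<Longrightarrow> J div nx < T"
  by (simp add: less_mult_imp_div_less)

lemma last_row_bound: "J < T * nx \<Longrightarrow> last_row J < T * (nx + nu)"
  using last_row_less[of J] mult_le_mono2[of "J div nx + 1" T "nx + nu"] div_less_T[of J]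
  by (simp add: mult.commute)

text \<open>A column of \<open>Q\<close> that no rotation has touched is a unit vector; these are the invariants
  \<open>Q_low_swept\<close> and \<open>Q_low\<close> below for the columns that enter with the sweep over column \<open>Suc J\<close>.\<close>

lemma last_row_Suc_ge:
  assumes "last_row J < c" "c \<le> last_row (Suc J)"
  shows "(nx + nu) * ((c - Suc J - 1) div nu) \<le> c"
    and "c < last_row (Suc J) \<Longrightarrow> (nx + nu) * ((c - Suc J) div nu) \<le> c"
proof -
  let ?k = "Suc J div nx"
  \<comment> \<open>Inside a block only one column enters; at the start of a block
    \<open>nu + 1\<close> columns enter, and the first of them attains equality.\<close>
  have low: "(nx + nu) * ?k \<le> c"
  proof (cases "Suc J mod nx = 0")
    case True
    then have "Suc J = nx * ?k" by auto
    moreover have "?k = Suc (J div nx)"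
      using True by (simp add: div_Suc)
    ultimately show ?thesis
      using assms by (simp add: last_row_def algebra_simps)
  next
    case False
    then have k: "?k = J div nx" by (simp add: div_Suc)
    have "nx * (J div nx) \<le> J" by simp
    then show ?thesis
      using assms unfolding k last_row_def add_mult_distrib add_mult_distrib2 by linarith
  qed
  have "(c - Suc J - 1) div nu \<le> ?k"
  proof -
    have "c - Suc J - 1 < (?k + 1) * nu"
      using assms nu_pos by (simp add: last_row_def algebra_simps)
    then show ?thesis by (metis less_mult_imp_div_less Suc_eq_plus1 less_Suc_eq_le)
  qed
  then show "(nx + nu) * ((c - Suc J - 1) div nu) \<le> c"
    using low by (meson le_trans mult_le_mono2)
  show "(nx + nu) * ((c - Suc J) div nu) \<le> c" if "c < last_row (Suc J)"
  proof -
    have "c - Suc J < (?k + 1) * nu"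
      using that nu_pos by (simp add: last_row_def algebra_simps)
    then have "(c - Suc J) div nu \<le> ?k" by (metis less_mult_imp_div_less Suc_eq_plus1 less_Suc_eq_le)
    then show ?thesis using low by (meson le_trans mult_le_mono2)
  qed
qed

end

text \<open>The state during the sweep over column \<open>J\<close> (all indices now count from 0), just before row \<open>q\<close>
  of that column is annihilated.  \<open>R_done\<close> and \<open>R_right\<close> justify the truncated range of columns in
  the R-step, \<open>Q_id\<close>, \<open>Q_low\<close> and \<open>Q_low_swept\<close> that of rows in the Q-step.  A sweep lowers the
  band bound of the columns of \<open>Q\<close> by one position, which is exactly what moving on from \<open>J\<close> to
  \<open>Suc J\<close> allows.\<close>

locale qr_mpc_state = qr_mpc_dims +
  fixes D :: "real mat" and J q :: nat and Q R :: "real mat"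
  assumes Q_carrier: "Q \<in> carrier_mat (T * (nx + nu)) (T * (nx + nu))"
    and R_carrier: "R \<in> carrier_mat (T * (nx + nu)) (T * nx)"
    and QR: "Q * R = D"
    and orth: "Q * transpose_mat Q = 1\<^sub>m (T * (nx + nu))"
    and R_below: "\<And>r c. r < T * (nx + nu) \<Longrightarrow> c < T * nx \<Longrightarrow> last_row c < r \<Longrightarrow> R $$ (r, c) = 0"
    and R_done: "\<And>r c. r < T * (nx + nu) \<Longrightarrow> c < T * nx \<Longrightarrow> c < J \<Longrightarrow> c < r \<Longrightarrow> R $$ (r, c) = 0"
    and R_swept: "\<And>r. r < T * (nx + nu) \<Longrightarrow> J < T * nx \<Longrightarrow> q < r \<Longrightarrow> R $$ (r, J) = 0"
    and R_right: "\<And>r c. r < T * (nx + nu) \<Longrightarrow> c < T * nx \<Longrightarrow> J div nx + 2 \<le> c div nx \<Longrightarrow>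
        r < (nx + nu) * (c div nx - 1) \<Longrightarrow> R $$ (r, c) = 0"
    and Q_id: "\<And>r c. r < T * (nx + nu) \<Longrightarrow> c < T * (nx + nu) \<Longrightarrow> last_row J < r \<or> last_row J < c \<Longrightarrow>
        Q $$ (r, c) = of_bool (r = c)"
    and Q_low: "\<And>r c. r < T * (nx + nu) \<Longrightarrow> J \<le> c \<Longrightarrow> c < q \<Longrightarrow> c \<le> last_row J \<Longrightarrow>
        r < (nx + nu) * ((c - J) div nu) \<Longrightarrow> Q $$ (r, c) = 0"
    and Q_low_swept: "\<And>r c. r < T * (nx + nu) \<Longrightarrow> J < c \<Longrightarrow> q \<le> c \<Longrightarrow> c \<le> last_row J \<Longrightarrow>
        r < (nx + nu) * ((c - J - 1) div nu) \<Longrightarrow> Q $$ (r, c) = 0"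

section \<open>Preservation of the invariant by a single rotation\<close>

text \<open>A recorded zero at a rotated index survives because its partner is zero too. The
  hypothesis \<open>zero\<close> supplies the one new zero, in row \<open>Suc p\<close> of column
  \<open>J\<close>.\<close>

lemma (in qr_mpc_dims) qr_mpc_state_rotate:
  assumes "qr_mpc_state nx nu T D J (Suc p) Q R"
    and J: "J < T * nx" and p: "J \<le> p" "Suc p \<le> last_row J"
    and cs: "c\<^sup>2 + s\<^sup>2 = 1" and zero: "s * R $$ (p, J) + c * R $$ (Suc p, J) = 0"
  shows "qr_mpc_state nx nu T D J p (rot_cols p (Suc p) c s Q) (rot_rows p (Suc p) c s R)"
proof -
  interpret qr_mpc_state nx nu T D J "Suc p" Q R by fact
  let ?l = "T * (nx + nu)"
  let ?Q = "rot_cols p (Suc p) c s Q" and ?R = "rot_rows p (Suc p) c s R"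
  have bound: "last_row J < ?l" using J by (rule last_row_bound)
  have Q': "?Q $$ (r, x) = plane_rot p (Suc p) c s (\<lambda>k. Q $$ (r, k)) x" if "r < ?l" "x < ?l" for r x
    using that Q_carrier by (auto simp: rot_cols_def)
  have R': "?R $$ (r, x) = plane_rot p (Suc p) c s (\<lambda>k. R $$ (k, x)) r" if "r < ?l" "x < T * nx" for r x
    using that R_carrier by (auto simp: rot_rows_def)
  have plane_rot_zero: "plane_rot p (Suc p) c s f x = 0"
    if "f x = 0" "x = p \<or> x = Suc p \<Longrightarrow> f p = 0 \<and> f (Suc p) = 0" for f x
    using that by (auto simp: plane_rot_def)
  have R_zero: "?R $$ (r, x) = 0"
    if "r < ?l" "x < T * nx" "R $$ (r, x) = 0"
      "r = p \<or> r = Suc p \<Longrightarrow> R $$ (p, x) = 0 \<and> R $$ (Suc p, x) = 0" for r x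
    unfolding R'[OF that(1,2)] by (rule plane_rot_zero) (use that in auto)
  have Q_zero: "?Q $$ (r, x) = 0"
    if "r < ?l" "x < ?l" "Q $$ (r, x) = 0"
      "x = p \<or> x = Suc p \<Longrightarrow> Q $$ (r, p) = 0 \<and> Q $$ (r, Suc p) = 0" for r x
    unfolding Q'[OF that(1,2)] by (rule plane_rot_zero) (use that in auto)
  \<comment> \<open>Column \<open>p\<close> obeys \<open>Q_low\<close> and column
    \<open>Suc p\<close> obeys \<open>Q_low_swept\<close>; the two bounds coincide because
    \<open>Suc p - J - 1 = p - J\<close>.\<close>
  have Q_pq: "Q $$ (r, p) = 0 \<and> Q $$ (r, Suc p) = 0"
    if "r < ?l" "r < (nx + nu) * ((p - J) div nu)" for r
    using Q_low[of r p] Q_low_swept[of r "Suc p"] that p by auto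
  show ?thesis
  proof
    show "?Q \<in> carrier_mat ?l ?l" "?R \<in> carrier_mat ?l (T * nx)"
      using Q_carrier R_carrier by auto
    show "?Q * ?R = D"
      using rot_cols_mult_rot_rows[OF Q_carrier R_carrier, of p "Suc p" c s] QR bound p cs by simp
    show "?Q * transpose_mat ?Q = 1\<^sub>m ?l"
      using rot_cols_mult_rot_rows[OF Q_carrier, of "transpose_mat Q" ?l p "Suc p" c s]
        Q_carrier orth bound p cs by (simp add: transpose_rot_cols)
  next
    fix r x assume r: "r < ?l" and x: "x < T * nx" and "last_row x < r"
    show "?R $$ (r, x) = 0"
    proof (rule R_zero[OF r x])
      show "R $$ (r, x) = 0" by (rule R_below) fact+
      assume *: "r = p \<or> r = Suc p"
      \<comment> \<open>Otherwise monotonicity would give \<open>Suc p \<le> last_row x < r\<close>.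
        So column \<open>x\<close> is finished and both rows lie below its diagonal.\<close>
      have "\<not> J \<le> x"
        using last_row_mono[of J x] * p \<open>last_row x < r\<close> by auto
      then show "R $$ (p, x) = 0 \<and> R $$ (Suc p, x) = 0"
        using R_done[of p x] R_done[of "Suc p" x] x p bound by auto
    qed
  next
    fix r x assume r: "r < ?l" and x: "x < T * nx" and "x < J" "x < r"
    show "?R $$ (r, x) = 0"
      by (rule R_zero[OF r x]) (use R_done r x \<open>x < J\<close> \<open>x < r\<close> p bound in auto)
  next
    fix r assume r: "r < ?l" and "p < r"
    show "?R $$ (r, J) = 0"
    proof (cases "r = Suc p")
      case True
      then show ?thesis using zero r J by (simp add: R' plane_rot_def)
    next
      case False
      then show ?thesis using R_swept[of r] r J \<open>p < r\<close> by (simp add: R' plane_rot_other)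
    qed
  next
    fix r x assume r: "r < ?l" and x: "x < T * nx" and block: "J div nx + 2 \<le> x div nx"
      and small: "r < (nx + nu) * (x div nx - 1)"
    have "(nx + nu) * (J div nx + 1) \<le> (nx + nu) * (x div nx - 1)"
      using block by (intro mult_le_mono2) auto
    then have "Suc p < (nx + nu) * (x div nx - 1)"
      using last_row_less[of J] p by linarith
    then show "?R $$ (r, x) = 0"
      by (intro R_zero[OF r x] conjI R_right r x block small) (use p bound in auto)
  next
    fix r x assume r: "r < ?l" and x: "x < ?l" and *: "last_row J < r \<or> last_row J < x"
    have "plane_rot p (Suc p) c s (\<lambda>k. Q $$ (r, k)) x = Q $$ (r, x)"
    proof (cases "last_row J < x")
      case True
      then show ?thesis using p by (intro plane_rot_other) auto
    next
      case False
      then show ?thesis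
        using * Q_id[of r p] Q_id[of r "Suc p"] r p bound by (intro plane_rot_trivial) auto
    qed
    then show "?Q $$ (r, x) = of_bool (r = x)"
      using Q_id[OF r x *] Q'[OF r x] by simp
  next
    fix r x assume r: "r < ?l" and x: "J \<le> x" "x < p" "x \<le> last_row J"
      and "r < (nx + nu) * ((x - J) div nu)"
    then show "?Q $$ (r, x) = 0"
      by (intro Q_zero Q_low) (use bound in auto)
  next
    fix r x assume r: "r < ?l" and x: "J < x" "p \<le> x" "x \<le> last_row J"
      and small: "r < (nx + nu) * ((x - J - 1) div nu)"
    \<comment> \<open>Column \<open>p\<close> now counts as swept, so its bound weakens; column
      \<open>Suc p\<close> keeps its bound.\<close>
    have "(x - J - 1) div nu \<le> (p - J) div nu" if "x = p \<or> x = Suc p"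
      using that by (auto intro: div_le_mono)
    then have pq: "Q $$ (r, p) = 0 \<and> Q $$ (r, Suc p) = 0" if "x = p \<or> x = Suc p"
      using that small r by (meson Q_pq mult_le_mono2 less_le_trans)
    show "?Q $$ (r, x) = 0"
    proof (cases "x = p \<or> x = Suc p")
      case True
      with pq show ?thesis by (intro Q_zero r) (use x bound in auto)
    next
      case False
      then show ?thesis
        using Q_low_swept[of r x] small r x bound by (intro Q_zero) auto
    qed
  qed
qed

text \<open>With tolerance 0, a skipped entry is already zero, so the position advances without a
  rotation; the bound for column \<open>p\<close> of \<open>Q\<close> merely weakens.\<close>

lemma (in qr_mpc_dims) qr_mpc_state_skip:
  assumes "qr_mpc_state nx nu T D J (Suc p) Q R"
    and J: "J < T * nx" and p: "J \<le> p" "Suc p \<le> last_row J" and zero: "R $$ (Suc p, J) = 0"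
  shows "qr_mpc_state nx nu T D J p Q R"
proof -
  interpret qr_mpc_state nx nu T D J "Suc p" Q R by fact
  show ?thesis
  proof
    show "R $$ (r, J) = 0" if "r < T * (nx + nu)" "p < r" for r
      using R_swept[of r] zero that J by (cases "r = Suc p") auto
    show "Q $$ (r, x) = 0"
      if "r < T * (nx + nu)" "J < x" "p \<le> x" "x \<le> last_row J"
        "r < (nx + nu) * ((x - J - 1) div nu)" for r x
    proof (cases "x = p")
      case True
      have "(x - J - 1) div nu \<le> (x - J) div nu" by (simp add: div_le_mono)
      then have "r < (nx + nu) * ((x - J) div nu)"
        using that by (meson mult_le_mono2 less_le_trans)
      then show ?thesis using True that by (intro Q_low) auto
    next
      case False
      then show ?thesis using that by (intro Q_low_swept) auto
    qed
  qed (use Q_carrier R_carrier QR orth R_below R_done R_right Q_id Q_low in auto)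
qed

text \<open>Counting from 0, the pair \<open>(Suc J, Suc (Suc p))\<close> is row
  \<open>Suc p\<close> of column \<open>J\<close>, with pivot row \<open>p\<close>. The invariants
  turn both truncated updates into full rotations.\<close>

lemma (in qr_mpc_dims) qr_mpc_state_step:
  assumes state: "qr_mpc_state nx nu T D J (Suc p) Q R"
    and J: "J < T * nx" and p: "J \<le> p" "Suc p \<le> last_row J"
    and step: "qr_mpc_step nx nu T 0 (Suc J, Suc (Suc p)) (Q, R) = (Q', R')"
  shows "qr_mpc_state nx nu T D J p Q' R'"
proof (cases "R $$ (Suc p, J) = 0")
  case True
  then have "Q' = Q" "R' = R" using step by (auto simp: entry_def)
  then show ?thesis using qr_mpc_state_skip[OF state J p True] by simp
next
  case False
  interpret qr_mpc_state nx nu T D J "Suc p" Q R by fact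
  let ?l = "T * (nx + nu)"
  have bound: "last_row J < ?l" using J by (rule last_row_bound)
  define d where "d = sqrt ((R $$ (p, J))\<^sup>2 + (R $$ (Suc p, J))\<^sup>2)"
  define c where "c = R $$ (p, J) / d"
  define s where "s = - R $$ (Suc p, J) / d"
  have d2: "d\<^sup>2 = (R $$ (p, J))\<^sup>2 + (R $$ (Suc p, J))\<^sup>2" by (simp add: d_def)
  have "c\<^sup>2 + s\<^sup>2 = d\<^sup>2 / d\<^sup>2"
    by (simp only: c_def s_def power_divide power2_minus add_divide_distrib d2)
  moreover have "d \<noteq> 0" using False by (auto simp: add_nonneg_eq_0_iff d_def)
  ultimately have cs: "c\<^sup>2 + s\<^sup>2 = 1" by simp
  have zero: "s * R $$ (p, J) + c * R $$ (Suc p, J) = 0"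
    by (simp add: c_def s_def)
  have r1: "qr_mpc_r1 nx nu (Suc J) = Suc (last_row J)"
    by (simp add: qr_mpc_r1_def last_row_def)
  \<comment> \<open>The 0-based first row of the Q-step: exactly the bound that columns
    \<open>p\<close> and \<open>Suc p\<close> share.\<close>
  define u where "u = (nx + nu) * ((p - J) div nu)"
  have q1: "qr_mpc_q1 nx nu (Suc J) (Suc (Suc p)) = Suc u"
    by (simp add: qr_mpc_q1_def u_def)
  define r2 where "r2 = qr_mpc_r2 nx T (Suc J)"
  have Q': "Q' = rot_cols p (Suc p) c s Q"
  proof -
    have "Q' = put_block Q (Suc u) (Suc p)
        (block Q (Suc u) (Suc (last_row J)) (Suc p) (Suc (Suc p)) * givens_mat c s)"
      using step False
      by (simp add: entry_def r1 q1 Let_def c_def s_def d_def)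
    also have "\<dots> = rot_cols p (Suc p) c s Q"
    proof (rule put_block_rot_cols)
      show "Suc p < dim_col Q" "Suc (last_row J) \<le> dim_row Q" using Q_carrier bound p by auto
      \<comment> \<open>Rows above \<open>u\<close> fall under the low bounds; in rows past
        \<open>last_row J\<close>, \<open>Q_id\<close> leaves only off-diagonal zeros.\<close>
      fix a assume a: "a < dim_row Q" "a < u \<or> Suc (last_row J) \<le> a"
      then show "Q $$ (a, p) = 0 \<and> Q $$ (a, Suc p) = 0"
        using Q_low[of a p] Q_low_swept[of a "Suc p"] Q_id[of a p] Q_id[of a "Suc p"]
          Q_carrier p bound by (auto simp: u_def)
    qed
    finally show ?thesis .
  qed
  have R': "R' = rot_rows p (Suc p) c s R"
  proof -
    have "R' = put_block R (Suc p) (Suc J)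
        (transpose_mat (givens_mat c s) * block R (Suc p) (Suc (Suc p)) (Suc J) r2)"
      using step False
      by (simp add: entry_def r2_def Let_def c_def s_def d_def)
    also have "\<dots> = rot_rows p (Suc p) c s R"
    proof (rule put_block_rot_rows)
      show "Suc p < dim_row R" using R_carrier bound p by auto
      show "r2 \<le> dim_col R" using R_carrier by (simp add: r2_def qr_mpc_r2_def mult.commute[of T])
      fix b assume b: "b < dim_col R" "b < J \<or> r2 \<le> b"
      then have b': "b < T * nx" using R_carrier by simp
      show "R $$ (p, b) = 0 \<and> R $$ (Suc p, b) = 0"
      proof (cases "b < J")
        case True
        then show ?thesis using R_done[of p b] R_done[of "Suc p" b] b' p bound by auto
      next
        case False
        then have "nx * min (J div nx + 2) T \<le> b"
          using b by (simp add: r2_def qr_mpc_r2_def)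
        \<comment> \<open>If \<open>T\<close> attains the minimum, \<open>r2\<close> is the full
          width and no column \<open>b\<close> remains.\<close>
        then have "nx * (J div nx + 2) \<le> b"
          using b' by (auto simp: min_def mult.commute[of T] split: if_splits)
        then have block: "J div nx + 2 \<le> b div nx"
          using nx_pos by (simp add: less_eq_div_iff_mult_less_eq mult.commute)
        then have "(nx + nu) * (J div nx + 1) \<le> (nx + nu) * (b div nx - 1)"
          by (intro mult_le_mono2) auto
        then have "Suc p < (nx + nu) * (b div nx - 1)"
          using last_row_less[of J] p by linarith
        then show ?thesis
          using p bound b' block by (intro conjI R_right) auto
      qed
    qed
    finally show ?thesis .
  qed
  show ?thesis
    unfolding Q' R' by (rule qr_mpc_state_rotate[OF state J p cs zero])
qed

section \<open>From single steps to the whole loop\<close>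

text \<open>The reversed range starts at the 1-based row \<open>q + 1\<close>, which is row
  \<open>q\<close>, so each step lowers \<open>q\<close> by one; at \<open>q = J\<close> the range
  is empty.\<close>

lemma (in qr_mpc_dims) qr_mpc_state_sweep:
  assumes "qr_mpc_state nx nu T D J q Q R" "J < T * nx" "J \<le> q" "q \<le> last_row J"
    and "fold (qr_mpc_step nx nu T 0) (map (Pair (Suc J)) (rev [Suc J + 1..<q + 2])) (Q, R) = (Q', R')"
  shows "qr_mpc_state nx nu T D J J Q' R'"
  using assms(3,1,2,4,5)
proof (induction q arbitrary: Q R rule: dec_induct)
  case base
  then show ?case by simp
next
  case (step p)
  obtain Q1 R1 where 1: "qr_mpc_step nx nu T 0 (Suc J, Suc (Suc p)) (Q, R) = (Q1, R1)"
    by fastforce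
  have "qr_mpc_state nx nu T D J p Q1 R1"
    using step.prems step.hyps 1 by (intro qr_mpc_state_step[OF _ _ _ _ 1]) auto
  moreover have "fold (qr_mpc_step nx nu T 0) (map (Pair (Suc J)) (rev [Suc J + 1..<p + 2])) (Q1, R1) = (Q', R')"
    using step.prems(4) step.hyps 1 by (simp del: qr_mpc_step.simps)
  ultimately show ?case
    using step.IH step.prems by auto
qed

text \<open>Since \<open>c - J - 1 = c - Suc J\<close>, the swept bound for \<open>J\<close> is the
  unswept bound for \<open>Suc J\<close>. Columns that enter now are unit vectors, and
  \<open>last_row_Suc_ge\<close> places the required zeros above their diagonal entry.\<close>

lemma (in qr_mpc_dims) qr_mpc_state_next:
  assumes "qr_mpc_state nx nu T D J J Q R" "Suc J < T * nx"
  shows "qr_mpc_state nx nu T D (Suc J) (last_row (Suc J)) Q R"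
proof -
  interpret qr_mpc_state nx nu T D J J Q R by fact
  have mono: "last_row J \<le> last_row (Suc J)" by (rule last_row_mono) simp
  have low: "Q $$ (r, c) = 0"
    if "r < T * (nx + nu)" "J < c" "c \<le> last_row (Suc J)"
      "r < (nx + nu) * ((c - Suc J) div nu)" "c \<le> last_row J \<or> r < c" for r c
  proof (cases "last_row J < c")
    case True
    then show ?thesis using Q_id[of r c] last_row_bound[OF assms(2)] that by auto
  next
    case False
    then show ?thesis using that by (intro Q_low_swept) auto
  qed
  show ?thesis
  proof
    show "R $$ (r, c) = 0" if "r < T * (nx + nu)" "c < T * nx" "c < Suc J" "c < r" for r c
      using R_done[of r c] R_swept[of r] that by (cases "c = J") auto
    show "R $$ (r, c) = 0"
      if "r < T * (nx + nu)" "c < T * nx" "Suc J div nx + 2 \<le> c div nx" "r < (nx + nu) * (c div nx - 1)" for r c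
    proof (rule R_right[OF that(1,2) _ that(4)])
      have "J div nx \<le> Suc J div nx" by (rule div_le_mono) simp
      then show "J div nx + 2 \<le> c div nx" using that by linarith
    qed
    show "Q $$ (r, c) = 0"
      if "r < T * (nx + nu)" "Suc J \<le> c" "c < last_row (Suc J)" "c \<le> last_row (Suc J)"
        "r < (nx + nu) * ((c - Suc J) div nu)" for r c
      using last_row_Suc_ge(2)[of J c] that by (intro low; cases "last_row J < c") auto
    \<comment> \<open>The new sweep starts at \<open>q = last_row (Suc J)\<close>, so this one
      column counts as swept from the outset.\<close>
    show "Q $$ (r, c) = 0"
      if "r < T * (nx + nu)" "Suc J < c" "last_row (Suc J) \<le> c" "c \<le> last_row (Suc J)"
        "r < (nx + nu) * ((c - Suc J - 1) div nu)" for r c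
    proof (rule low)
      have "(c - Suc J - 1) div nu \<le> (c - Suc J) div nu" by (rule div_le_mono) simp
      then show "r < (nx + nu) * ((c - Suc J) div nu)"
        using that by (meson mult_le_mono2 less_le_trans)
      show "c \<le> last_row J \<or> r < c"
        using last_row_Suc_ge(1)[of J c] that by linarith
    qed (use that in auto)
  qed (use Q_carrier R_carrier QR orth R_below Q_id mono assms in auto)
qed

text \<open>A column with block index \<open>k\<close> of the transposed constraint matrix is
  supported on at most the row blocks \<open>k - 1\<close> and \<open>k\<close>, and ends with the
  -1 of the identity block. The bounds on the initial \<open>Q\<close> are void, since the quotients
  by \<open>nu\<close> are all 0.\<close>

lemma (in qr_mpc_dims) qr_mpc_state_init:
  assumes "T > 0" and D: "D = transpose_mat (mpc_mat nx nu T A B)"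
  shows "qr_mpc_state nx nu T D 0 (last_row 0) (1\<^sub>m (T * (nx + nu))) D"
proof
  have index: "D $$ (r, c) = mpc_mat nx nu T A B $$ (c, r)" if "r < T * (nx + nu)" "c < T * nx" for r c
    using that by (simp add: D mpc_mat_def)
  have div_mod: "r = (nx + nu) * (r div (nu + nx)) + r mod (nu + nx)" for r
    by (simp add: add.commute[of nx])
  show D_carrier: "D \<in> carrier_mat (T * (nx + nu)) (T * nx)"
    by (simp add: D mpc_mat_def)
  then show "1\<^sub>m (T * (nx + nu)) * D = D" by simp
  show below: "D $$ (r, c) = 0"
    if "r < T * (nx + nu)" "c < T * nx" "last_row c < r" for r c
  proof -
    let ?k = "c div nx" and ?a = "c mod nx" and ?h = "r div (nu + nx)" and ?b = "r mod (nu + nx)"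
    have "?b < nu + nx" using nx_pos by simp
    have "last_row c = (nx + nu) * ?k + nu + ?a"
    proof -
      show ?thesis
        using mult_div_mod_eq[of nx c] unfolding last_row_def add_mult_distrib add_mult_distrib2
        by linarith
    qed
    then have less: "(nx + nu) * ?k + nu + ?a < (nx + nu) * ?h + ?b"
      using that div_mod[of r] by simp
    have "?k \<le> ?h"
    proof (rule ccontr)
      assume "\<not> ?k \<le> ?h"
      then have "(nx + nu) * Suc ?h \<le> (nx + nu) * ?k" by (intro mult_le_mono2) simp
      then show False using less \<open>?b < nu + nx\<close> by simp
    qed
    \<comment> \<open>In the diagonal block the strict inequality forces an off-diagonal entry of
      the negated identity.\<close>
    moreover have "(- 1\<^sub>m nx :: real mat) $$ (?a, ?b - nu) = 0" "nu \<le> ?b" if "?h = ?k"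
    proof -
      have "nu + ?a < ?b" using less that by simp
      then have "?b - nu < nx" "?a < ?b - nu" "?a < nx"
        using \<open>?b < nu + nx\<close> nx_pos by (linarith, linarith, simp)
      then show "(- 1\<^sub>m nx :: real mat) $$ (?a, ?b - nu) = 0"
        by (simp add: less_imp_neq)
      show "nu \<le> ?b" using \<open>nu + ?a < ?b\<close> by simp
    qed
    ultimately show ?thesis
      using that by (auto simp: index mpc_mat_def Let_def)
  qed
  show "D $$ (r, 0) = 0" if "r < T * (nx + nu)" "0 < T * nx" "last_row 0 < r" for r
    using below that by blast
  show "D $$ (r, c) = 0"
    if "r < T * (nx + nu)" "c < T * nx" "0 div nx + 2 \<le> c div nx" "r < (nx + nu) * (c div nx - 1)" for r c
  proof -
    \<comment> \<open>This excludes \<open>h = k\<close> and \<open>Suc h = k\<close>, the only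
      cases of \<open>mpc_mat\<close> with nonzero entries.\<close>
    have "r div (nu + nx) < c div nx - 1"
      using that(4) by (simp add: less_mult_imp_div_less mult.commute add.commute[of nx])
    then show ?thesis
      using that by (auto simp: index mpc_mat_def Let_def)
  qed
  have "nu < T * (nx + nu)"
    using last_row_bound[of 0] nx_pos \<open>T > 0\<close> by (simp add: last_row_def)
  moreover have "(c - 1) div nu = 0" if "c \<le> nu" for c
    using that nu_pos by (intro div_less) auto
  ultimately show "1\<^sub>m (T * (nx + nu)) $$ (r, c) = 0"
    if "r < T * (nx + nu)" "last_row 0 \<le> c" "c \<le> last_row 0" "0 < c"
      "r < (nx + nu) * ((c - 0 - 1) div nu)" for r c
    using that by (simp add: last_row_def)
qed (auto simp: last_row_def)

text \<open>Induction over the columns, splitting off the last sweep. The algorithm's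
  \<open>j\<close> is \<open>Suc J\<close>, hence the bound \<open>J + 2\<close>.\<close>

lemma (in qr_mpc_dims) qr_mpc_state_sweeps:
  assumes "T > 0" "D = transpose_mat (mpc_mat nx nu T A B)" "J < T * nx"
    and "fold (qr_mpc_step nx nu T 0)
      (concat (map (\<lambda>j. map (Pair j) (rev [j + 1..<qr_mpc_r1 nx nu j + 1])) [1..<J + 2]))
      (1\<^sub>m (T * (nx + nu)), D) = (Q, R)"
  shows "qr_mpc_state nx nu T D J J Q R"
  using assms(3,4)
proof (induction J arbitrary: Q R)
  case 0
  have upt: "[1..<0 + 2] = [Suc 0]" "qr_mpc_r1 nx nu (Suc 0) + 1 = last_row 0 + 2"
    by (simp_all add: upt_rec qr_mpc_r1_def last_row_def)
  show ?case
    using 0(2) unfolding upt list.map concat.simps append_Nil2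
    by (rule qr_mpc_state_sweep[OF qr_mpc_state_init[OF assms(1,2)] 0(1) le0 order_refl])
next
  case (Suc J)
  let ?sweep = "\<lambda>j. map (Pair j) (rev [j + 1..<qr_mpc_r1 nx nu j + 1])"
  obtain Q1 R1 where 1: "fold (qr_mpc_step nx nu T 0)
      (concat (map ?sweep [1..<J + 2])) (1\<^sub>m (T * (nx + nu)), D) = (Q1, R1)"
    by fastforce
  have "qr_mpc_state nx nu T D J J Q1 R1"
    using Suc.IH[OF _ 1] Suc.prems by simp
  then have "qr_mpc_state nx nu T D (Suc J) (last_row (Suc J)) Q1 R1"
    using Suc.prems by (intro qr_mpc_state_next)
  moreover have "fold (qr_mpc_step nx nu T 0) (?sweep (Suc (Suc J))) (Q1, R1) = (Q, R)"
  proof -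
    have upt: "[1..<Suc J + 2] = [1..<J + 2] @ [Suc (Suc J)]" by simp
    show ?thesis
      using Suc.prems(2) unfolding upt map_append concat_append fold_append comp_def 1 by simp
  qed
  moreover have "Suc J \<le> last_row (Suc J)" and r1: "qr_mpc_r1 nx nu (Suc (Suc J)) + 1 = last_row (Suc J) + 2"
    by (simp_all add: last_row_def qr_mpc_r1_def)
  ultimately show ?case
    using Suc.prems(1) unfolding r1 by (blast intro: qr_mpc_state_sweep)
qed

section \<open>Partitioned factors and correctness of the algorithm\<close>

lemma append_cols_split:
  assumes "M \<in> carrier_mat m (n + k)"
  obtains M1 M2 where "M1 \<in> carrier_mat m n" "M2 \<in> carrier_mat m k" "M = M1 @\<^sub>c M2"
proof
  let ?M1 = "mat m n (($$) M)" and ?M2 = "mat m k (\<lambda>(i, j). M $$ (i, n + j))"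
  show "?M1 \<in> carrier_mat m n" "?M2 \<in> carrier_mat m k" by simp_all
  show "M = ?M1 @\<^sub>c ?M2"
    using assms by (intro eq_matI) (auto simp: append_cols_def)
qed

lemma append_rows_zero_split:
  assumes "M \<in> carrier_mat (n + k) m"
    and "\<And>i j. i < n + k \<Longrightarrow> n \<le> i \<Longrightarrow> j < m \<Longrightarrow> M $$ (i, j) = 0"
  shows "M = mat n m (($$) M) @\<^sub>r 0\<^sub>m k m"
  using assms by (intro eq_matI) (auto simp: append_rows_def)

lemma qr_mpc_correct:
  assumes "nx > 0" "nu > 0" "T > 0"
    and qr: "qr_mpc (mpc_mat nx nu T A B) nu nx T 0 = (Q, R)"
  shows "Q \<in> carrier_mat (T * (nx + nu)) (T * (nx + nu))"
    and "R \<in> carrier_mat (T * (nx + nu)) (T * nx)"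
    and "Q * transpose_mat Q = 1\<^sub>m (T * (nx + nu))"
    and "Q * R = transpose_mat (mpc_mat nx nu T A B)"
    and "\<And>i j. i < T * (nx + nu) \<Longrightarrow> j < T * nx \<Longrightarrow> j < i \<Longrightarrow> R $$ (i, j) = 0"
proof -
  interpret qr_mpc_dims nx nu T using assms by unfold_locales
  define J where "J = T * nx - 1"
  have J: "J < T * nx" "T * nx + 1 = J + 2" using assms by (simp_all add: J_def)
  interpret qr_mpc_state nx nu T "transpose_mat (mpc_mat nx nu T A B)" J J Q R
    using qr by (intro qr_mpc_state_sweeps[OF \<open>T > 0\<close> refl J(1)])
      (simp only: qr_mpc_def qr_mpc_loop_def J(2))
  show "Q \<in> carrier_mat (T * (nx + nu)) (T * (nx + nu))" "R \<in> carrier_mat (T * (nx + nu)) (T * nx)"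
    "Q * transpose_mat Q = 1\<^sub>m (T * (nx + nu))" "Q * R = transpose_mat (mpc_mat nx nu T A B)"
    by (fact Q_carrier R_carrier orth QR)+
  \<comment> \<open>\<open>R_done\<close> covers all columns but the last, which
    \<open>R_swept\<close> covers with \<open>q = J\<close>.\<close>
  show "R $$ (i, j) = 0" if "i < T * (nx + nu)" "j < T * nx" "j < i" for i j
    using R_done[of i j] R_swept[of i] J that by (cases "j = J") auto
qed

section \<open>Flop counts\<close>

lemma sum_list_map_concat:
  "sum_list (map f (concat xss)) = (\<Sum>xs\<leftarrow>xss. sum_list (map f xs))"
  by (induction xss) auto

lemma sum_blocks:
  fixes g :: "nat \<Rightarrow> 'a :: comm_monoid_add"
  shows "(\<Sum>J<T * n. g J) = (\<Sum>k<T. \<Sum>a<n. g (k * n + a))"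
proof -
  have "sum g {k * n..<k * n + n} = (\<Sum>a<n. g (k * n + a))" for k
    by (subst sum.atLeastLessThan_shift_0) (auto simp: atLeast0LessThan)
  then show ?thesis
    by (simp flip: sum.nat_group)
qed

text \<open>With \<open>j = k * nx + a + 1\<close> and \<open>i = j + 1 + t\<close>, the floor in
  \<open>r1\<close> and \<open>r2\<close> becomes \<open>k\<close>, and each column of block
  \<open>k\<close> has \<open>nu * (k + 1)\<close> rotations.\<close>

lemma real_sum_qr_mpc_loop:
  assumes "nx > 0"
  shows "real (\<Sum>(j, i)\<leftarrow>qr_mpc_loop nx nu T. f j i)
    = (\<Sum>k<T. \<Sum>a<nx. \<Sum>t<nu * (k + 1). real (f (Suc (k * nx + a)) (k * nx + a + 2 + t)))"
proof -
  have "(\<Sum>(j, i)\<leftarrow>qr_mpc_loop nx nu T. f j i)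
      = (\<Sum>j\<leftarrow>[1..<T * nx + 1]. \<Sum>i\<leftarrow>rev [j + 1..<qr_mpc_r1 nx nu j + 1]. f j i)"
    by (simp add: qr_mpc_loop_def sum_list_map_concat comp_def)
  also have "\<dots> = (\<Sum>j = 1..<T * nx + 1. \<Sum>i = j + 1..<qr_mpc_r1 nx nu j + 1. f j i)"
    by (simp only: rev_map[symmetric] sum_list_rev interv_sum_list_conv_sum_set_nat set_upt)
  also have "\<dots> = (\<Sum>J<T * nx. \<Sum>t<nu * (J div nx + 1). f (Suc J) (J + 2 + t))"
    by (subst (1 2) sum.atLeastLessThan_shift_0)
      (auto simp: qr_mpc_r1_def atLeast0LessThan intro!: sum.cong)
  finally show ?thesis
    using assms unfolding sum_blocks of_nat_sum by simp
qed

lemma sum_lessThan_real: "(\<Sum>a<n. real a) = real n * (real n - 1) / 2"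
  by (induction n) (auto simp: field_simps)

text \<open>The R-step spans \<open>2 * nx - a\<close> columns, but only \<open>nx - a\<close> in
  the last block; that exception is the negative term.\<close>

lemma real_chi_R:
  assumes "nx > 0"
  shows "real (chi_R nx nu T) =
    3 / 2 * real nu * nx * (3 * real nx + 1) * T * (real T + 1) - 6 * real nu * T * real nx ^ 2"
proof -
  have summand: "real (qr_mpc_r2 nx T (Suc (k * nx + a)) - Suc (k * nx + a) + 1)
      = nx * min 2 (real T - k) - a" if "k < T" "a < nx" for k a
  proof -
    have "nx * (k + 1) \<le> nx * min (k + 2) T"
      using that by (intro mult_le_mono2) simp
    then have "k * nx + nx \<le> nx * min (k + 2) T"
      by (simp add: algebra_simps)
    then have "Suc (k * nx + a) \<le> nx * min (k + 2) T"
      using that by linarith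
    moreover have "real (nx * min (k + 2) T) = nx * (k + min 2 (real T - k))"
      by (auto simp: min_def)
    ultimately show ?thesis
      using that assms by (simp add: qr_mpc_r2_def of_nat_diff algebra_simps)
  qed
  have "real (chi_R nx nu T) =
      (\<Sum>k<T. \<Sum>a<nx. \<Sum>t<nu * (k + 1).
         6 * real (qr_mpc_r2 nx T (Suc (k * nx + a)) - Suc (k * nx + a) + 1))"
    unfolding chi_R_def real_sum_qr_mpc_loop[OF assms] mult_flops_rotation of_nat_mult by simp
  also have "\<dots> = (\<Sum>k<T. \<Sum>a<nx. \<Sum>t<nu * (k + 1). 6 * (nx * min 2 (real T - k) - a))"
    by (intro sum.cong refl arg_cong2[of _ _ _ _ "(*)"] summand) auto
  also have "\<dots> = (\<Sum>k<T. 6 * nu * (k + 1) * (\<Sum>a<nx. nx * min 2 (real T - k) - a))"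
    by (simp only: sum_constant card_lessThan of_nat_mult of_nat_numeral sum_distrib_left mult_ac)
  also have "\<dots> = (\<Sum>k<T. 6 * nu * (k + 1) * (nx ^ 2 * min 2 (real T - k) - real nx * (real nx - 1) / 2))"
    by (simp add: sum_subtractf sum_lessThan_real power2_eq_square algebra_simps)
  also have "\<dots> = 3 / 2 * real nu * nx * (3 * real nx + 1) * T * (real T + 1) - 6 * real nu * T * real nx ^ 2"
  proof (cases T)
    \<comment> \<open>For \<open>k < N\<close> the minimum is 2; the summand \<open>k = N\<close> is
      the last block and is evaluated apart.\<close>
    case (Suc N)
    have "(\<Sum>k<N. 6 * real nu * (k + 1) * (nx ^ 2 * min 2 (real T - k) - real nx * (real nx - 1) / 2))
        = (\<Sum>k<N. real (k + 1) * (6 * real nu * (nx ^ 2 * 2 - real nx * (real nx - 1) / 2)))"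
      using Suc by (intro sum.cong) (auto simp: min_def)
    also have "\<dots> = real N * (real N + 1) / 2 * (6 * real nu * (nx ^ 2 * 2 - real nx * (real nx - 1) / 2))"
      unfolding sum_distrib_right[symmetric] by (simp add: sum.distrib sum_lessThan_real field_simps)
    finally show ?thesis
      using Suc by (simp add: field_simps power2_eq_square)
  qed simp
  finally show ?thesis .
qed

text \<open>With \<open>t = m * nu + b\<close> the floor in \<open>q1\<close> is \<open>m\<close>,
  and the Q-step has height \<open>(nx + nu) * (k - m) + a + 1 + nu\<close>. Summing
  \<open>k - m\<close> yields the cubic term.\<close>

lemma real_chi_Q:
  assumes "nx > 0" "nu > 0"
  shows "real (chi_Q nx nu T) =
    real nu * nx * (real nx + nu) * (real T ^ 3 - T)
      + 3 * real nu * nx * T * (real T + 1) * ((real nx + 1) / 2 + nu)"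
proof -
  have summand: "real (qr_mpc_r1 nx nu (Suc (k * nx + a))
        - qr_mpc_q1 nx nu (Suc (k * nx + a)) (k * nx + a + 2 + (m * nu + b)) + 1)
      = (real nx + nu) * (real k - real m) + real a + 1 + real nu" (is "real (?r - ?q + 1) = _")
    if "a < nx" "m < k + 1" "b < nu" for k a m b
  proof -
    have "m \<le> k" using that by simp
    then obtain d where "k = m + d"
      using le_Suc_ex by blast
    moreover have "?r = Suc (k * nx + a) + nu * (k + 1)" "?q = 1 + (nx + nu) * m"
      using that by (simp_all add: qr_mpc_r1_def qr_mpc_q1_def)
    ultimately have "?r - ?q + 1 = (nx + nu) * d + a + 1 + nu"
      by (simp add: algebra_simps)
    with \<open>k = m + d\<close> show ?thesis
      by (simp del: of_nat_add) (simp add: algebra_simps)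
  qed
  have "real (chi_Q nx nu T) =
      (\<Sum>k<T. \<Sum>a<nx. \<Sum>m<k + 1. \<Sum>b<nu.
         6 * real (qr_mpc_r1 nx nu (Suc (k * nx + a))
        - qr_mpc_q1 nx nu (Suc (k * nx + a)) (k * nx + a + 2 + (m * nu + b)) + 1))"
    \<comment> \<open>Commuting the bound to \<open>(k + 1) * nu\<close> lets
      \<open>sum_blocks\<close> group the rotations by their common \<open>q1\<close>.\<close>
    unfolding chi_Q_def real_sum_qr_mpc_loop[OF assms(1)] mult.commute[of nu] sum_blocks
      mult_flops_rotation of_nat_mult by simp
  also have "\<dots> = (\<Sum>k<T. \<Sum>a<nx. \<Sum>m<k + 1. \<Sum>b<nu. 6 * ((real nx + nu) * (real k - real m) + real a + 1 + real nu))"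
    by (intro sum.cong refl arg_cong2[of _ _ _ _ "(*)"] summand) auto
  also have "\<dots> = (\<Sum>k<T. 6 * nu * (\<Sum>a<nx. \<Sum>m<k + 1. (real nx + nu) * (real k - real m) + real a + 1 + real nu))"
    by (simp only: sum_constant card_lessThan of_nat_mult of_nat_numeral sum_distrib_left mult_ac)
  also have "\<dots> = (\<Sum>k<T. 6 * nu * (nx * (real nx + nu) * (k * (real k + 1) / 2)
        + (k + 1) * (nx * (real nx + 1) / 2 + nx * nu)))"
  proof (intro sum.cong refl arg_cong2[of _ _ _ _ "(*)"])
    fix k :: nat
    have "(\<Sum>m<k + 1. (real nx + nu) * (real k - real m) + real a + 1 + real nu)
        = (real nx + nu) * (k * (real k + 1) / 2) + (k + 1) * (real a + 1 + nu)" for a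
      unfolding sum.distrib sum_distrib_left[symmetric] sum_subtractf sum_lessThan_real
      by (simp add: field_simps)
    then show "(\<Sum>a<nx. \<Sum>m<k + 1. (real nx + nu) * (real k - real m) + real a + 1 + real nu)
        = nx * (real nx + nu) * (k * (real k + 1) / 2) + (k + 1) * (nx * (real nx + 1) / 2 + nx * nu)"
      by (simp add: sum.distrib sum_lessThan_real flip: sum_distrib_left) (simp add: field_simps)
  qed
  also have "\<dots> = real nu * nx * (real nx + nu) * (real T ^ 3 - T)
      + 3 * real nu * nx * T * (real T + 1) * ((real nx + 1) / 2 + nu)"
    by (induction T) (simp_all add: field_simps power2_eq_square power3_eq_cube)
  finally show ?thesis .
qed

lemma real_givens_qr_flops:
  assumes "n \<le> m"
  shows "real (givens_qr_flops m n) = 6 * real n * real m ^ 2 - real n ^ 3 - 3 * real n ^ 2 - 2 * real n"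
proof -
  \<comment> \<open>Here \<open>c\<close> stands for \<open>m + n + 1\<close>; keeping
    \<open>N\<close> apart from it leaves the summand fixed during the induction.\<close>
  have sum: "(\<Sum>j = 1..N. 6 * (real m - real j) * (c - real j)) =
      6 * real N * m * c - 3 * (real m + c) * N * (real N + 1) + real N * (real N + 1) * (2 * real N + 1)"
    for N :: nat and c :: real
    by (induction N) (simp_all add: algebra_simps)
  have "real (givens_qr_flops m n) = (\<Sum>j = 1..n. 6 * (real m - real j) * (real m + n + 1 - real j))"
    unfolding givens_qr_flops_eq of_nat_sum using assms
    by (intro sum.cong) (auto simp: of_nat_diff algebra_simps)
  also have "(\<Sum>j = 1..n. 6 * (real m - real j) * (real m + n + 1 - real j))
      = 6 * real n * real m ^ 2 - real n ^ 3 - 3 * real n ^ 2 - 2 * real n"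
    unfolding sum by (simp add: algebra_simps power2_eq_square power3_eq_cube)
  finally show ?thesis .
qed

section \<open>Growth in the horizon\<close>

text \<open>The cubic and quadratic terms match exactly; \<open>K\<close> collects the coefficients
  of \<open>real T\<close> in \<open>real_chi_R\<close> and \<open>real_chi_Q\<close>.\<close>

lemma chi_QR_asymp:
  assumes "nx > 0" and "nu > 0"
  shows "(\<lambda>T. real (chi_QR nx nu T)
         - (real T ^ 3 * (real nx ^ 2 * real nu + real nx * real nu ^ 2)
            + 3 * real T ^ 2 * real nu * real nx * (2 * real nx + real nu + 1)))
       \<in> O(\<lambda>T. real T)"
proof -
  define K where "K = 3 / 2 * real nu * nx * (3 * real nx + 1) - 6 * real nu * real nx ^ 2
    - real nu * nx * (real nx + nu) + 3 * real nu * nx * ((real nx + 1) / 2 + nu)"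
  have "real (chi_QR nx nu T)
         - (real T ^ 3 * (real nx ^ 2 * real nu + real nx * real nu ^ 2)
            + 3 * real T ^ 2 * real nu * real nx * (2 * real nx + real nu + 1)) = K * real T" for T
    using assms unfolding chi_QR_def of_nat_add real_chi_R[OF assms(1)] real_chi_Q[OF assms] K_def
    by (simp add: field_simps power2_eq_square power3_eq_cube)
  then show ?thesis by simp
qed

text \<open>The leading part \<open>6 * n * m ^ 2 - n ^ 3\<close> of the dense count has cubic
  coefficients 5, 12, 6; subtracting 0, 1, 1 for QR-MPC leaves 5, 11, 5. What remains is quadratic,
  linear and the error \<open>e\<close> of the previous lemma.\<close>

lemma chi_QRS_asymp:
  assumes "nx > 0" and "nu > 0"
  shows "(\<lambda>T. real T ^ 3 * (5 * real nx ^ 3 + 11 * real nx ^ 2 * real nu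
                                + 5 * real nx * real nu ^ 2)
               - (real (chi_QRS nx nu T) - real (chi_QR nx nu T)))
             \<in> O(\<lambda>T. real T ^ 2)"
proof -
  define e where "e T = real (chi_QR nx nu T)
         - (real T ^ 3 * (real nx ^ 2 * real nu + real nx * real nu ^ 2)
            + 3 * real T ^ 2 * real nu * real nx * (2 * real nx + real nu + 1))" for T
  have "e \<in> O(\<lambda>T. real T)"
    using chi_QR_asymp[OF assms] by (simp add: e_def[abs_def])
  also have linear: "(\<lambda>T. real T) \<in> O(\<lambda>T. real T ^ 2)"
    by (rule landau_o.big_mono) (auto intro!: always_eventually self_le_power
      simp: power2_eq_square simp flip: of_nat_mult)
  finally have e: "e \<in> O(\<lambda>T. real T ^ 2)" .
  have "real T ^ 3 * (5 * real nx ^ 3 + 11 * real nx ^ 2 * real nu + 5 * real nx * real nu ^ 2)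
        - (real (chi_QRS nx nu T) - real (chi_QR nx nu T))
      = e T + (3 * real nu * nx * (2 * real nx + nu + 1) + 3 * real nx ^ 2) * real T ^ 2
        + 2 * real nx * real T" for T
    unfolding chi_QRS_def e_def
    by (subst real_givens_qr_flops) (simp_all add: algebra_simps power2_eq_square power3_eq_cube)
  moreover have "(\<lambda>T. e T + (3 * real nu * nx * (2 * real nx + nu + 1) + 3 * real nx ^ 2) * real T ^ 2
        + 2 * real nx * real T) \<in> O(\<lambda>T. real T ^ 2)"
    by (intro sum_in_bigo e landau_o.big.cmult_in_iff'[THEN iffD2]) (use linear in simp_all)
  ultimately show ?thesis
    by simp
qed

theorem lemmaV1:
  fixes nx nu :: nat
  assumes "nx > 0" and "nu > 0"
  shows "(\<forall>T A B C Q R.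
            T > 0 \<longrightarrow>
            (\<forall>k. 1 \<le> k \<and> k < T \<longrightarrow> A k \<in> carrier_mat nx nx) \<longrightarrow>
            (\<forall>k < T. B k \<in> carrier_mat nx nu) \<longrightarrow>
            C = mpc_mat nx nu T A B \<longrightarrow>
            vec_space.rank (T * nx) C = T * nx \<longrightarrow>
            qr_mpc C nu nx T 0 = (Q, R) \<longrightarrow>
            (\<exists>Q\<^sub>1 Q\<^sub>2 R\<^sub>1.
               Q\<^sub>1 \<in> carrier_mat (T * (nx + nu)) (T * nx) \<and>
               Q\<^sub>2 \<in> carrier_mat (T * (nx + nu)) (T * nu) \<and>
               R\<^sub>1 \<in> carrier_mat (T * nx) (T * nx) \<and>
               Q = Q\<^sub>1 @\<^sub>c Q\<^sub>2 \<and>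
               R = R\<^sub>1 @\<^sub>r 0\<^sub>m (T * nu) (T * nx) \<and>
               inverts_mat (transpose_mat Q) Q \<and> inverts_mat Q (transpose_mat Q) \<and>
               upper_triangular R\<^sub>1 \<and>
               Q * R = transpose_mat C))
         \<and> (\<lambda>T. real (chi_QR nx nu T)
               - (real T ^ 3 * (real nx ^ 2 * real nu + real nx * real nu ^ 2)
                  + 3 * real T ^ 2 * real nu * real nx * (2 * real nx + real nu + 1)))
             \<in> O(\<lambda>T. real T)
         \<and> (\<lambda>T. real T ^ 3 * (5 * real nx ^ 3 + 11 * real nx ^ 2 * real nu
                                + 5 * real nx * real nu ^ 2)
               - (real (chi_QRS nx nu T) - real (chi_QR nx nu T)))
             \<in> O(\<lambda>T. real T ^ 2)"
proof (intro conjI allI impI)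
  fix T and A B :: "nat \<Rightarrow> real mat" and C Q R
  assume "T > 0" and C: "C = mpc_mat nx nu T A B" and "qr_mpc C nu nx T 0 = (Q, R)"
  then have "qr_mpc (mpc_mat nx nu T A B) nu nx T 0 = (Q, R)" by simp
  note correct = qr_mpc_correct[OF assms \<open>T > 0\<close> this]
  have l: "T * (nx + nu) = T * nx + T * nu" by (rule add_mult_distrib2)
  obtain Q1 Q2 where Q: "Q1 \<in> carrier_mat (T * (nx + nu)) (T * nx)"
      "Q2 \<in> carrier_mat (T * (nx + nu)) (T * nu)" "Q = Q1 @\<^sub>c Q2"
    using correct(1) append_cols_split[of Q "T * (nx + nu)" "T * nx" "T * nu"] l by metis
  define R1 where "R1 = mat (T * nx) (T * nx) (($$) R)"
  have "R1 \<in> carrier_mat (T * nx) (T * nx)"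
    by (simp add: R1_def)
  moreover have "R = R1 @\<^sub>r 0\<^sub>m (T * nu) (T * nx)"
    unfolding R1_def using correct(2,5) by (intro append_rows_zero_split) (auto simp: l)
  moreover have "upper_triangular R1"
    using correct(5) by (auto simp: R1_def l)
  moreover have "inverts_mat Q (transpose_mat Q)"
    using correct(1,3) by (simp add: inverts_mat_def)
  \<comment> \<open>The invariant gives one order of the product; squareness of \<open>Q\<close>
    gives the other.\<close>
  moreover have "inverts_mat (transpose_mat Q) Q"
    using correct(1,3) mat_mult_left_right_inverse[of Q "T * (nx + nu)" "transpose_mat Q"]
    by (simp add: inverts_mat_def)
  ultimately show "\<exists>Q\<^sub>1 Q\<^sub>2 R\<^sub>1.
               Q\<^sub>1 \<in> carrier_mat (T * (nx + nu)) (T * nx) \<and>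
               Q\<^sub>2 \<in> carrier_mat (T * (nx + nu)) (T * nu) \<and>
               R\<^sub>1 \<in> carrier_mat (T * nx) (T * nx) \<and>
               Q = Q\<^sub>1 @\<^sub>c Q\<^sub>2 \<and>
               R = R\<^sub>1 @\<^sub>r 0\<^sub>m (T * nu) (T * nx) \<and>
               inverts_mat (transpose_mat Q) Q \<and> inverts_mat Q (transpose_mat Q) \<and>
               upper_triangular R\<^sub>1 \<and>
               Q * R = transpose_mat C"
    using Q correct(4) C by blast
next
  show "(\<lambda>T. real (chi_QR nx nu T)
         - (real T ^ 3 * (real nx ^ 2 * real nu + real nx * real nu ^ 2)
            + 3 * real T ^ 2 * real nu * real nx * (2 * real nx + real nu + 1)))
       \<in> O(\<lambda>T. real T)"
    by (rule chi_QR_asymp[OF assms])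
next
  show "(\<lambda>T. real T ^ 3 * (5 * real nx ^ 3 + 11 * real nx ^ 2 * real nu
                          + 5 * real nx * real nu ^ 2)
         - (real (chi_QRS nx nu T) - real (chi_QR nx nu T)))
       \<in> O(\<lambda>T. real T ^ 2)"
    by (rule chi_QRS_asymp[OF assms])
qed

end
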